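(* If $n$ is a positive integer and $p$ is an integer, then $$\sum_{k=0}^n(-1)^{(p-1)(n-k)}\frac{n}{n+k}\binom{n+k}{n-k}L_p^{2k}=\frac{L_{2pn}}{2},$$ $$\sum_{k=0}^n(-1)^{p(n-k)}\frac{n}{n+k}\binom{n+k}{n-k}5^kF_p^{2k}=\frac{L_{2pn}}{2}.$$
   Context: $F_n$ and $L_n$ ($n\in\mathbb{Z}$) are the Fibonacci and Lucas numbers: $F_0=0$, $F_1=1$, $F_n=F_{n-1}+F_{n-2}$; $L_0=2$, $L_1=1$, $L_n=L_{n-1}+L_{n-2}$, extended to negative indices by $F_{-n}=(-1)^{n-1}F_n$, $L_{-n}=(-1)^nL_n$. The convention $0^0=1$ is used. *)

theory Defs
  imports Complex_Main "HOL-Number_Theory.Fib"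
begin

fun lucas :: "nat \<Rightarrow> nat" where
  "lucas 0 = 2"
| "lucas (Suc 0) = 1"
| "lucas (Suc (Suc n)) = lucas (Suc n) + lucas n"

text \<open>
  Extensions to negative indices by \<open>F\<^sub>-\<^sub>m = (-1)\<^bsup>m-1\<^esup> F\<^sub>m\<close> and \<open>L\<^sub>-\<^sub>m = (-1)\<^bsup>m\<^esup> L\<^sub>m\<close>.
  In the negative branch \<open>m = nat (- n)\<close> is at least 1, so the subtraction does not truncate.
\<close>

definition fib_int :: "int \<Rightarrow> int" where
  "fib_int n = (if n \<ge> 0 then int (fib (nat n))
                else (-1) ^ (nat (- n) - 1) * int (fib (nat (- n))))"

definition lucas_int :: "int \<Rightarrow> int" where
  "lucas_int n = (if n \<ge> 0 then int (lucas (nat n))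
                  else (-1) ^ nat (- n) * int (lucas (nat (- n))))"

end

theory Submission
  imports Defs
begin

text \<open>
  Twice the coefficient \<open>n/(n+k) * C(n+k, n-k)\<close> is \<open>C(n+k, 2k) + C(n+k-1, 2k)\<close>, so the sum with
  weights \<open>x^k s^(n-k)\<close> is \<open>(U\<^sub>n + s U\<^sub>n\<^sub>-\<^sub>1) / 2\<close> for the Morgan-Voyce polynomials
  \<open>U\<^sub>n = (\<Sum>k. C(n+k, 2k) x^k s^(n-k))\<close>. These satisfy a recurrence with characteristic roots
  \<open>a, b\<close> given by \<open>a + b = x + 2 s\<close> and \<open>a b = s^2\<close>, and the sum is \<open>(a^n + b^n) / 2\<close>.
  By Binet's formulas, \<open>a = \<phi>^(2 p)\<close> and \<open>b = \<psi>^(2 p)\<close> fit both \<open>x = L\<^sub>p^2\<close>,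
  \<open>s = (-1)^(p-1)\<close> and \<open>x = 5 F\<^sub>p^2\<close>, \<open>s = (-1)^p\<close>.
\<close>

section \<open>Homogenised Morgan-Voyce polynomials\<close>

definition morgan_voyce_b :: "'a::comm_ring_1 \<Rightarrow> 'a \<Rightarrow> nat \<Rightarrow> 'a" where
  "morgan_voyce_b x s n = (\<Sum>k\<le>n. of_nat ((n + k) choose (2 * k)) * x ^ k * s ^ (n - k))"

definition morgan_voyce_B :: "'a::comm_ring_1 \<Rightarrow> 'a \<Rightarrow> nat \<Rightarrow> 'a" where
  "morgan_voyce_B x s n = (\<Sum>k\<le>n. of_nat ((n + k + 1) choose (2 * k + 1)) * x ^ k * s ^ (n - k))"

text \<open>The added top term has coefficient \<open>(2 * n + 1) choose (2 * n + 2)\<close>, which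
  is 0; the range and powers now match those of index \<open>Suc n\<close>.\<close>

lemma mult_morgan_voyce_b:
  "s * morgan_voyce_b x s n = (\<Sum>k\<le>Suc n. of_nat ((n + k) choose (2 * k)) * x ^ k * s ^ (Suc n - k))"
  by (simp add: morgan_voyce_b_def sum_distrib_left Suc_diff_le binomial_eq_0 mult_ac)

lemma mult_morgan_voyce_B:
  "s * morgan_voyce_B x s n
    = (\<Sum>k\<le>Suc n. of_nat ((n + k + 1) choose (2 * k + 1)) * x ^ k * s ^ (Suc n - k))"
  by (simp add: morgan_voyce_B_def sum_distrib_left Suc_diff_le binomial_eq_0 mult_ac)

text \<open>Pascal's rule; shifting \<open>k\<close> by one in the part with odd lower index pulls
  out the factor \<open>x\<close>.\<close>

lemma morgan_voyce_b_Suc: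
  "morgan_voyce_b x s (Suc n) = s * morgan_voyce_b x s n + x * morgan_voyce_B x s n"
  unfolding mult_morgan_voyce_b
  unfolding morgan_voyce_b_def morgan_voyce_B_def sum.atMost_Suc_shift sum_distrib_left
  by (simp add: sum.distrib [symmetric] binomial_eq_0 algebra_simps)

lemma morgan_voyce_B_Suc:
  "morgan_voyce_B x s (Suc n) = s * morgan_voyce_B x s n + morgan_voyce_b x s (Suc n)"
  unfolding mult_morgan_voyce_B
  unfolding morgan_voyce_b_def morgan_voyce_B_def sum.distrib [symmetric]
  by (rule sum.cong) (auto simp: binomial_eq_0 algebra_simps)

text \<open>Elimination of \<open>morgan_voyce_B\<close>. Only the product
  \<open>x * morgan_voyce_B x s n\<close> is replaced, so no division by \<open>x\<close>
  occurs.\<close>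

lemma morgan_voyce_b_Suc_Suc:
  "morgan_voyce_b x s (Suc (Suc n))
    = (x + 2 * s) * morgan_voyce_b x s (Suc n) - s ^ 2 * morgan_voyce_b x s n"
proof -
  have "morgan_voyce_b x s (Suc (Suc n))
      = (s + x) * morgan_voyce_b x s (Suc n) + s * (x * morgan_voyce_B x s n)"
    by (subst morgan_voyce_b_Suc) (simp add: morgan_voyce_B_Suc algebra_simps)
  also have "x * morgan_voyce_B x s n = morgan_voyce_b x s (Suc n) - s * morgan_voyce_b x s n"
    by (simp add: morgan_voyce_b_Suc)
  finally show ?thesis
    by (simp add: algebra_simps power2_eq_square)
qed

text \<open>Both sides satisfy the recurrence with coefficients \<open>a + b\<close> and
  \<open>- (a * b)\<close>, so two initial values suffice.\<close>

lemma morgan_voyce_b_power_sum: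
  fixes a b :: "'a::comm_ring_1"
  assumes "a + b = x + 2 * s" "a * b = s ^ 2"
  shows "morgan_voyce_b x s (Suc n) + s * morgan_voyce_b x s n = a ^ Suc n + b ^ Suc n"
proof (induction n rule: induct_nat_012)
  case 0
  show ?case
    using assms by (simp add: morgan_voyce_b_def numeral_2_eq_2)
next
  case 1
  \<comment> \<open>The left side is the expanded sum for index 1, the right side is
    \<open>a ^ 2 + b ^ 2\<close>.\<close>
  have "x ^ 2 + 4 * s * x + 2 * s ^ 2 = (a + b) ^ 2 - 2 * (a * b)"
    unfolding assms by (simp add: algebra_simps power2_eq_square)
  then show ?case
    by (simp add: morgan_voyce_b_def numeral_eq_Suc algebra_simps)
next
  case (ge2 n)
  have "morgan_voyce_b x s (Suc (Suc (Suc n))) + s * morgan_voyce_b x s (Suc (Suc n))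
      = (x + 2 * s) * (morgan_voyce_b x s (Suc (Suc n)) + s * morgan_voyce_b x s (Suc n))
        - s ^ 2 * (morgan_voyce_b x s (Suc n) + s * morgan_voyce_b x s n)"
    by (simp only: morgan_voyce_b_Suc_Suc) (simp add: algebra_simps)
  also have "\<dots> = (a + b) * (a ^ Suc (Suc n) + b ^ Suc (Suc n)) - (a * b) * (a ^ Suc n + b ^ Suc n)"
    by (simp only: ge2.IH assms)
  also have "\<dots> = a ^ Suc (Suc (Suc n)) + b ^ Suc (Suc (Suc n))"
    by (simp add: algebra_simps)
  finally show ?case .
qed

section \<open>Reduction of the weighted sum to a power sum\<close>

text \<open>Write \<open>2 * n\<close> as \<open>(n + k) + (n - k)\<close> and absorb the factor
  \<open>n - k\<close> into the binomial.\<close>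

lemma lucas_coefficient:
  fixes n k :: nat
  assumes "n > 0" "k \<le> n"
  shows "real n / real (n + k) * real ((n + k) choose (n - k))
    = (real ((n + k) choose (2 * k)) + real ((n + k - 1) choose (2 * k))) / 2"
proof -
  have "(n + k) choose (n - k) = (n + k) choose (2 * k)"
    using binomial_symmetric [of "n - k" "n + k"] assms by (simp add: mult_2)
  moreover have "real (n - k) * real ((n + k) choose (2 * k))
      = real (n + k) * real ((n + k - 1) choose (2 * k))"
    using binomial_absorb_comp [of "n + k" "2 * k"]
    by (simp only: of_nat_mult [symmetric]) (simp add: mult_2)
  ultimately show ?thesis
    using assms by (simp add: field_simps of_nat_diff)
qed

lemma sum_lucas_coefficient:
  fixes a b x s :: real
  assumes "n > 0" "a + b = x + 2 * s" "a * b = s ^ 2"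
  shows "(\<Sum>k=0..n. s ^ (n - k) * (real n / real (n + k)) * real ((n + k) choose (n - k)) * x ^ k)
    = (a ^ n + b ^ n) / 2"
proof -
  obtain m where n: "n = Suc m"
    using assms(1) by (cases n) auto
  have "(\<Sum>k=0..n. s ^ (n - k) * (real n / real (n + k)) * real ((n + k) choose (n - k)) * x ^ k)
      = (\<Sum>k\<le>n. (real ((n + k) choose (2 * k)) * x ^ k * s ^ (n - k)
            + real ((m + k) choose (2 * k)) * x ^ k * s ^ (n - k)) / 2)"
  proof (rule sum.cong)
    fix k assume "k \<in> {..n}"
    then have "real n / real (n + k) * real ((n + k) choose (n - k))
        = (real ((n + k) choose (2 * k)) + real ((m + k) choose (2 * k))) / 2"
      using lucas_coefficient [of n k] by (simp add: n)
    then show "s ^ (n - k) * (real n / real (n + k)) * real ((n + k) choose (n - k)) * x ^ k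
        = (real ((n + k) choose (2 * k)) * x ^ k * s ^ (n - k)
            + real ((m + k) choose (2 * k)) * x ^ k * s ^ (n - k)) / 2"
      \<comment> \<open>Reassociation exposes the coefficient as the product that the preceding
        equation rewrites.\<close>
      by (simp only: mult.assoc [of "s ^ (n - k)"]) (simp add: algebra_simps)
  qed auto
  also have "\<dots> = (morgan_voyce_b x s n + s * morgan_voyce_b x s m) / 2"
    unfolding n mult_morgan_voyce_b
    by (simp only: morgan_voyce_b_def sum_divide_distrib [symmetric] sum.distrib)
  finally show ?thesis
    using morgan_voyce_b_power_sum [OF assms(2,3)] by (simp add: n)
qed

section \<open>Binet's formulas for integer indices\<close>

definition golden :: real where
  "golden = (1 + sqrt 5) / 2"

definition golden_conj :: real where
  "golden_conj = (1 - sqrt 5) / 2"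

lemma golden_square: "golden * golden = golden + 1"
  by (simp add: golden_def field_simps)

lemma golden_conj_square: "golden_conj * golden_conj = golden_conj + 1"
  by (simp add: golden_conj_def field_simps)

lemma golden_mult_conj: "golden * golden_conj = -1"
  by (simp add: golden_def golden_conj_def field_simps)

lemma golden_nonzero [simp]: "golden \<noteq> 0" "golden_conj \<noteq> 0"
  using golden_mult_conj by auto

lemma inverse_golden: "inverse golden = - golden_conj" "inverse golden_conj = - golden"
  using golden_mult_conj by (auto simp: field_simps)

lemma lucas_Binet: "real (lucas n) = golden ^ n + golden_conj ^ n"
proof (induction n rule: induct_nat_012)
  case (ge2 n)
  have "golden ^ Suc (Suc n) = golden ^ n * (golden * golden)"
    "golden_conj ^ Suc (Suc n) = golden_conj ^ n * (golden_conj * golden_conj)"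
    by simp_all
  then show ?case
    using ge2 by (simp add: golden_square golden_conj_square algebra_simps)
qed (auto simp: golden_def golden_conj_def field_simps)

lemma fib_Binet: "sqrt 5 * real (fib n) = golden ^ n - golden_conj ^ n"
proof (induction n rule: induct_nat_012)
  case (ge2 n)
  have "golden ^ Suc (Suc n) = golden ^ n * (golden * golden)"
    "golden_conj ^ Suc (Suc n) = golden_conj ^ n * (golden_conj * golden_conj)"
    by simp_all
  then show ?case
    using ge2 by (simp add: golden_square golden_conj_square algebra_simps)
qed (auto simp: golden_def golden_conj_def field_simps)

text \<open>The roots have product -1, so inversion swaps them up to sign.\<close>

lemma golden_powi_neg:
  "golden powi (- int m) = (-1) ^ m * golden_conj ^ m"
  "golden_conj powi (- int m) = (-1) ^ m * golden ^ m"
  by (simp_all add: power_int_minus power_inverse [symmetric] inverse_golden power_minus [of golden]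
      power_minus [of golden_conj])

lemma lucas_int_Binet: "real_of_int (lucas_int p) = golden powi p + golden_conj powi p"
proof (cases "p \<ge> 0")
  case True
  then show ?thesis
    by (simp add: lucas_int_def lucas_Binet power_int_def)
next
  case False
  then obtain m where m: "p = - int m" "m > 0"
    by (metis linorder_not_le neg_int_cases)
  then show ?thesis
    unfolding m(1) golden_powi_neg by (simp add: lucas_int_def lucas_Binet algebra_simps)
qed

lemma fib_int_Binet: "sqrt 5 * real_of_int (fib_int p) = golden powi p - golden_conj powi p"
proof (cases "p \<ge> 0")
  case True
  then show ?thesis
    by (simp add: fib_int_def fib_Binet power_int_def)
next
  case False
  \<comment> \<open>With \<open>Suc m\<close> the sign exponent \<open>nat (- p) - 1\<close> is
    \<open>m\<close>; the swap of the roots in the difference absorbs the remaining sign.\<close>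
  then obtain m where m: "p = - int (Suc m)"
    by (metis linorder_not_le neg_int_cases gr0_implies_Suc)
  have "sqrt 5 * real_of_int (fib_int p) = (-1) ^ m * (sqrt 5 * real (fib (Suc m)))"
    by (simp add: fib_int_def m nat_add_distrib)
  also have "\<dots> = golden powi p - golden_conj powi p"
    unfolding m golden_powi_neg fib_Binet by (simp add: algebra_simps)
  finally show ?thesis .
qed

lemma golden_powi_mult_conj: "golden powi p * golden_conj powi p = (-1) powi p"
  by (simp add: power_int_mult_distrib [symmetric] golden_mult_conj)

lemma square_minus_one_powi: "((-1 :: real) powi p) ^ 2 = 1"
  by (simp add: power_int_minus_left)

lemma lucas_int_square:
  "real_of_int (lucas_int p) ^ 2 = (golden powi p) ^ 2 + (golden_conj powi p) ^ 2 + 2 * (-1) powi p"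
  unfolding lucas_int_Binet golden_powi_mult_conj [symmetric]
  by (simp add: algebra_simps power2_eq_square)

lemma fib_int_square:
  "5 * real_of_int (fib_int p) ^ 2 = (golden powi p) ^ 2 + (golden_conj powi p) ^ 2 - 2 * (-1) powi p"
proof -
  have "5 * real_of_int (fib_int p) ^ 2 = (sqrt 5 * real_of_int (fib_int p)) ^ 2"
    by (simp add: power_mult_distrib)
  then show ?thesis
    unfolding fib_int_Binet golden_powi_mult_conj [symmetric]
    by (simp add: algebra_simps power2_eq_square)
qed

lemma lucas_int_double_mult:
  "real_of_int (lucas_int (2 * p * int n)) = ((golden powi p) ^ 2) ^ n + ((golden_conj powi p) ^ 2) ^ n"
proof -
  have "x powi (2 * p * int n) = ((x powi p) ^ 2) ^ n" for x :: real
    by (simp add: power_int_mult mult.commute [of 2 p])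
  then show ?thesis
    by (simp add: lucas_int_Binet)
qed

text \<open>Brings the sign into the form \<open>s ^ (n - k)\<close> with
  \<open>s = (-1) powi q\<close>.\<close>

lemma minus_one_powi_mult_diff:
  assumes "k \<le> n"
  shows "(-1 :: real) powi (q * (int n - int k)) = ((-1) powi q) ^ (n - k)"
  by (simp add: power_int_mult of_nat_diff [OF assms, symmetric] del: of_nat_diff)

theorem theorem3:
  fixes n :: nat and p :: int
  assumes "n > 0"
  shows "(\<Sum>k=0..n. (-1) powi ((p - 1) * (int n - int k)) * (real n / real (n + k))
            * real ((n + k) choose (n - k)) * real_of_int (lucas_int p) ^ (2 * k))
          = real_of_int (lucas_int (2 * p * int n)) / 2
       \<and> (\<Sum>k=0..n. (-1) powi (p * (int n - int k)) * (real n / real (n + k))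
            * real ((n + k) choose (n - k)) * 5 ^ k * real_of_int (fib_int p) ^ (2 * k))
          = real_of_int (lucas_int (2 * p * int n)) / 2"
proof
  let ?a = "(golden powi p) ^ 2" and ?b = "(golden_conj powi p) ^ 2"
  \<comment> \<open>Any \<open>q\<close> is allowed because the square of a sign is 1; this serves
    both \<open>q = p - 1\<close> and \<open>q = p\<close>.\<close>
  have ab: "?a * ?b = ((-1) powi q) ^ 2" for q
    by (simp only: power_mult_distrib [symmetric] golden_powi_mult_conj square_minus_one_powi)
  \<comment> \<open>The sign change turns the cross term of the Lucas square into
    \<open>- 2 * s\<close>.\<close>
  have shift: "(-1 :: real) powi (p - 1) = - ((-1) powi p)"
    by (simp add: power_int_diff)
  have "?a + ?b = real_of_int (lucas_int p) ^ 2 + 2 * (-1) powi (p - 1)"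
    by (simp add: lucas_int_square shift)
  from sum_lucas_coefficient [OF assms this ab]
  show "(\<Sum>k=0..n. (-1) powi ((p - 1) * (int n - int k)) * (real n / real (n + k))
            * real ((n + k) choose (n - k)) * real_of_int (lucas_int p) ^ (2 * k))
          = real_of_int (lucas_int (2 * p * int n)) / 2"
    by (simp add: lucas_int_double_mult minus_one_powi_mult_diff power_mult)
  have "?a + ?b = 5 * real_of_int (fib_int p) ^ 2 + 2 * (-1) powi p"
    by (simp add: fib_int_square)
  from sum_lucas_coefficient [OF assms this ab]
  show "(\<Sum>k=0..n. (-1) powi (p * (int n - int k)) * (real n / real (n + k))
            * real ((n + k) choose (n - k)) * 5 ^ k * real_of_int (fib_int p) ^ (2 * k))
          = real_of_int (lucas_int (2 * p * int n)) / 2"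
    unfolding lucas_int_double_mult
    by (simp add: minus_one_powi_mult_diff power_mult power_mult_distrib mult.assoc)
qed

end
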